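(* Let $\mathbb{X}$ be an $n$-dimensional real polyhedral Banach space and let $f \in S_{\mathbb{X}^*}$. Then $f$ is an extreme point of $B_{\mathbb{X}^*}$ if and only if $f$ is a supporting functional corresponding to a facet of $B_{\mathbb{X}}$.
   Context: All Banach spaces are real. For a Banach space $\mathbb{X}$, $B_{\mathbb{X}}=\{x\in\mathbb{X}:\|x\|\le 1\}$, $S_{\mathbb{X}}=\{x\in\mathbb{X}:\|x\|=1\}$, and $\mathbb{X}^*$ is the dual space with the dual norm. A finite-dimensional Banach space $\mathbb{X}$ is polyhedral if $B_{\mathbb{X}}$ has only finitely many extreme points; equivalently, $B_{\mathbb{X}}$ is a polyhedron, i.e. a non-empty compact set that is an intersection of finitely many closed half-spaces. The dimension of a polyhedron $P$ is the dimension of the subspace generated by the differences $v-w$ with $v,w\in P$. A polyhedron $Q$ is a face of the polyhedron $P$ if $Q=P$ or $Q=P\cap\delta M$, where $M$ is a closed half-space containing $P$ and $\delta M$ is its boundary. With $n=\dim\mathbb{X}$, a facet of $B_{\mathbb{X}}$ is an $(n-1)$-dimensional face of $B_{\mathbb{X}}$. For a facet $F$ of $B_{\mathbb{X}}$, a functional $f\in S_{\mathbb{X}^*}$ is a supporting functional corresponding to the facet $F$ if (1) $f$ attains its norm at some point $v\in F$ (i.e. $f(v)=\|f\|=1$), and (2) $F=(v+\ker f)\cap S_{\mathbb{X}}$. *)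

theory Defs
  imports "HOL-Analysis.Analysis"
begin

(* A Banach space is a type of class banach, its dual is the type of bounded linear
   functionals with the operator norm.  The library's polyhedron and facet_of require an
   inner product (euclidean_space), and its face_of is not the hyperplane-section notion. *)

definition polyhedral_space :: "'a::banach itself \<Rightarrow> bool" where
  "polyhedral_space _ \<longleftrightarrow>
     (\<exists>B::'a set. finite B \<and> span B = UNIV) \<and>
     finite {x. x extreme_point_of cball (0::'a) 1}"

definition closed_halfspace :: "'a::real_normed_vector set \<Rightarrow> bool" where
  "closed_halfspace M \<longleftrightarrow>
     (\<exists>(g::'a \<Rightarrow>\<^sub>L real) c. g \<noteq> 0 \<and> M = {x. blinfun_apply g x \<le> c})"

definition bounded_polyhedron :: "'a::real_normed_vector set \<Rightarrow> bool" where
  "bounded_polyhedron P \<longleftrightarrow>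
     P \<noteq> {} \<and> compact P \<and> (\<exists>H. finite H \<and> (\<forall>M\<in>H. closed_halfspace M) \<and> P = \<Inter>H)"

definition polyhedron_dim :: "'a::real_normed_vector set \<Rightarrow> nat" where
  "polyhedron_dim P = dim (span {v - w | v w. v \<in> P \<and> w \<in> P})"

definition polyhedron_face :: "'a::real_normed_vector set \<Rightarrow> 'a set \<Rightarrow> bool" where
  "polyhedron_face Q P \<longleftrightarrow>
     bounded_polyhedron P \<and> bounded_polyhedron Q \<and>
     (Q = P \<or> (\<exists>M. closed_halfspace M \<and> P \<subseteq> M \<and> Q = P \<inter> frontier M))"

(* The dimension condition is dim F = dim X - 1, written without truncated subtraction. *)
definition unit_ball_facet :: "'a::banach set \<Rightarrow> bool" where
  "unit_ball_facet F \<longleftrightarrow>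
     polyhedron_face F (cball 0 1) \<and> polyhedron_dim F + 1 = dim (UNIV::'a set)"

definition supporting_functional :: "('a::banach \<Rightarrow>\<^sub>L real) \<Rightarrow> 'a set \<Rightarrow> bool" where
  "supporting_functional f F \<longleftrightarrow>
     norm f = 1 \<and>
     (\<exists>v\<in>F. blinfun_apply f v = norm f \<and>
        F = (\<lambda>x. v + x) ` {x. blinfun_apply f x = 0} \<inter> sphere 0 1)"

end

theory Submission
  imports Defs
begin

text \<open>
  Both conditions on \<open>f\<close> say that the points of the unit ball at which \<open>f\<close> equals \<open>1\<close> span the whole
  space. For facets this is a dimension count (\<open>span_UNIV_iff_polyhedron_dim\<close>): a nonempty set on which \<open>f\<close>
  is \<open>1\<close> spans exactly when the differences of its points span a hyperplane, the kernel of \<open>f\<close>.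

  For extreme points, let \<open>E\<close> be the finite set of extreme points of the ball. By a Krein-Milman
  argument, the dual ball consists of the \<open>f\<close> with \<open>f e \<le> 1\<close> for all \<open>e\<close> in \<open>E\<close>
  (\<open>norm_le_1_iff_extreme_points\<close>). As for every polyhedron, a point of it is extreme only if its
  active constraints have full rank, that is, if the \<open>e\<close> with \<open>f e = 1\<close> span
  (\<open>extreme_point_imp_span_contact_points\<close>). Conversely, two functionals of norm at most \<open>1\<close> whose
  proper convex combination is \<open>1\<close> on a spanning subset of the ball coincide
  (\<open>extreme_point_if_span_contact_set\<close>).

  A facet must also be a section of a ball that is an intersection of finitely many half-spaces
  (\<open>bounded_polyhedron_unit_ball\<close>). The half-spaces are given by the functionals in the dual ball with
  spanning contact points, which are finite in number. They suffice because a norming functional from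
  the Hahn-Banach theorem can be pushed, without decreasing its value at a given point, until its
  contact points span (\<open>exists_dominating_spanning_contact_functional\<close>).

  The space is known only through a finite spanning set and a norm, so compactness of balls, boundedness
  of linear functionals and the Hahn-Banach theorem are derived from that set by elementary means.
\<close>

section \<open>Compactness and functionals in finite dimension\<close>

lemma closed_if_cball_sections_compact:
  fixes S :: "'a::real_normed_vector set"
  assumes "\<And>r. compact (S \<inter> cball 0 r)"
  shows "closed S"
  unfolding closed_sequential_limits
proof (intro allI impI, elim conjE)
  fix x l
  assume x: "\<forall>n. x n \<in> S" and l: "x \<longlonglongrightarrow> l"
  obtain r where "\<forall>n. norm (x n) \<le> r"
    using convergent_imp_bounded[OF l] by (auto simp: bounded_iff)
  then have "\<forall>n. x n \<in> S \<inter> cball 0 r" using x by auto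
  moreover have "closed (S \<inter> cball 0 r)" by (rule compact_imp_closed[OF assms])
  ultimately show "l \<in> S" using l closed_sequentially by blast
qed

text \<open>Induction on the spanning set. The closed subspace \<open>span S\<close> has a positive distance
  \<open>d\<close> to a new vector \<open>a\<close>, so the coefficient of \<open>a\<close> in a vector of norm at most \<open>r\<close> is bounded
  by \<open>r / d\<close>. The ball therefore sits inside the sum of a compact segment and a compact piece of
  \<open>span S\<close>.\<close>

lemma compact_span_Int_cball:
  fixes S :: "'a::real_normed_vector set"
  assumes "finite S"
  shows "compact (span S \<inter> cball 0 r)"
  using assms
proof (induction S arbitrary: r rule: finite_induct)
  case empty
  have "span {} \<inter> cball 0 r = (if r < 0 then {} else {0::'a})" by auto
  then show ?case by simp
next
  case (insert a S)
  show ?case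
  proof (cases "a \<in> span S")
    case True
    then show ?thesis using insert.IH by (simp add: span_redundant)
  next
    case False
    have "closed (span S)"
      using insert.IH by (rule closed_if_cball_sections_compact)
    then have "infdist a (span S) > 0"
      using infdist_pos_not_in_closed[OF _ _ False] span_zero by blast
    then obtain d where d: "d > 0" "d = infdist a (span S)" by blast
    let ?A = "(\<lambda>t. t *\<^sub>R a) ` {-(r/d)..r/d}"
    let ?K = "{x + y |x y. x \<in> ?A \<and> y \<in> span S \<inter> cball 0 (r + r / d * norm a)}"
    have K: "compact ?K"
      by (intro compact_sums compact_continuous_image continuous_intros insert.IH) auto
    have "span (insert a S) \<inter> cball 0 r = ?K \<inter> cball 0 r"
    proof (intro equalityI subsetI)
      fix x assume "x \<in> ?K \<inter> cball 0 r"
      then show "x \<in> span (insert a S) \<inter> cball 0 r"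
        using span_mono[of S "insert a S"]
        by (auto intro!: span_add span_scale span_base[of a])
    next
      fix x assume x: "x \<in> span (insert a S) \<inter> cball 0 r"
      then obtain t where t: "x - t *\<^sub>R a \<in> span S"
        by (auto simp: span_breakdown_eq)
      have le: "\<bar>t\<bar> * d \<le> norm x"
      proof (cases "t = 0")
        case False
        have "a - (1/t) *\<^sub>R x = (-1/t) *\<^sub>R (x - t *\<^sub>R a)"
          using False by (simp add: algebra_simps)
        then have "a - (1/t) *\<^sub>R x \<in> span S" using span_scale[OF t] by metis
        then have "infdist a (span S) \<le> dist a (a - (1/t) *\<^sub>R x)"
          by (rule infdist_le)
        also have "\<dots> = norm x / \<bar>t\<bar>" by (simp add: dist_norm)
        finally show ?thesis using False d by (simp add: field_simps)
      qed simp
      then have tr: "\<bar>t\<bar> \<le> r / d"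
        using x d by (simp add: field_simps)
      have "norm (x - t *\<^sub>R a) \<le> norm x + \<bar>t\<bar> * norm a"
        using norm_triangle_ineq4[of x "t *\<^sub>R a"] by simp
      also have "\<dots> \<le> r + r / d * norm a"
        using x tr by (intro add_mono mult_right_mono) auto
      finally have "x - t *\<^sub>R a \<in> span S \<inter> cball 0 (r + r / d * norm a)"
        using t by simp
      moreover have "t *\<^sub>R a \<in> ?A" using tr by (intro imageI) (simp add: abs_le_iff minus_le_iff)
      moreover have "x = t *\<^sub>R a + (x - t *\<^sub>R a)" by simp
      ultimately show "x \<in> ?K \<inter> cball 0 r" using x by blast
    qed
    then show ?thesis using compact_Int_closed[OF K closed_cball] by simp
  qed
qed

lemma closed_subspace_if_finite_span:
  fixes W B :: "'a::real_normed_vector set"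
  assumes B: "finite B" "span B = UNIV" and W: "subspace W"
  shows "closed W"
proof -
  obtain C where C: "C \<subseteq> W" "independent C" "W \<subseteq> span C"
    using basis_exists[of W] by metis
  have "finite C" using independent_span_bound[OF B(1) C(2)] B(2) by auto
  moreover have "span C = W" using C W by (metis span_subspace)
  ultimately show ?thesis
    using closed_if_cball_sections_compact compact_span_Int_cball by metis
qed

text \<open>If \<open>f a = 1\<close>, then \<open>a - x / f x\<close> lies in the kernel whenever \<open>f x \<noteq> 0\<close>. As the kernel is
  closed, \<open>a\<close> stays at a positive distance \<open>d\<close> from it, which gives \<open>\<bar>f x\<bar> \<le> norm x / d\<close>.\<close>

lemma linear_imp_bounded_linear_if_finite_span:
  fixes f :: "'a::real_normed_vector \<Rightarrow> real"
  assumes B: "finite B" "span B = (UNIV::'a set)" and f: "linear f"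
  shows "bounded_linear f"
proof (cases "\<forall>x. f x = 0")
  case True
  then have "f = (\<lambda>x. 0)" by auto
  then show ?thesis by simp
next
  case False
  then obtain b where b: "f b \<noteq> 0" by auto
  define a where "a = (1 / f b) *\<^sub>R b"
  have a: "f a = 1" using b f by (simp add: a_def linear_scale)
  let ?W = "{x. f x = 0}"
  have W: "subspace ?W" using f by (rule linear_subspace_kernel)
  have pos: "infdist a ?W > 0"
  proof (rule infdist_pos_not_in_closed[OF closed_subspace_if_finite_span[OF B W]])
    show "?W \<noteq> {}" using subspace_0[OF W] by blast
    show "a \<notin> ?W" using a by simp
  qed
  have bound: "norm (f x) \<le> norm x * (1 / infdist a ?W)" for x
  proof (cases "f x = 0")
    case False
    have "f (a - (1 / f x) *\<^sub>R x) = 0"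
      using f a False by (simp add: linear_diff linear_scale)
    then have "infdist a ?W \<le> dist a (a - (1 / f x) *\<^sub>R x)"
      by (intro infdist_le) simp
    also have "\<dots> = norm x / \<bar>f x\<bar>" by (simp add: dist_norm)
    finally show ?thesis using False pos by (simp add: field_simps)
  qed (use pos in simp)
  show ?thesis
    by (rule bounded_linear_intro[OF linear_add[OF f] linear_scale[OF f] bound])
qed

lemma linear_functional_separating_subspace:
  fixes W :: "'a::real_vector set"
  assumes W: "subspace W" and a: "a \<notin> W"
  obtains h :: "'a \<Rightarrow> real" where "linear h" "\<And>x. x \<in> W \<Longrightarrow> h x = 0" "h a = 1"
proof -
  obtain C where C: "C \<subseteq> W" "independent C" "W \<subseteq> span C"
    using basis_exists[of W] by metis
  have sC: "span C = W" using C W by (metis span_subspace)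
  then have "independent (insert a C)" using a C by (simp add: independent_insert)
  then obtain h :: "'a \<Rightarrow> real" where h: "linear h"
    "\<forall>x\<in>insert a C. h x = (if x = a then 1 else 0)"
    using linear_independent_extend[of "insert a C" "\<lambda>x. if x = a then 1 else (0::real)"] by blast
  have "h x = 0" if "x \<in> W" for x
  proof (rule linear_eq_0_on_span[OF h(1)])
    show "x \<in> span C" using that sC by simp
    show "h c = 0" if "c \<in> C" for c using that h(2) a C(1) by auto
  qed
  then show ?thesis using that h by auto
qed

text \<open>The spanning set is exhausted one vector at a time. All functionals are defined on the whole space,
  so that extending \<open>g\<close> from \<open>W\<close> to \<open>W + span {a}\<close> means adding a multiple of a functional that
  vanishes on \<open>W\<close> and is \<open>1\<close> at \<open>a\<close>. The new value \<open>c\<close> at \<open>a\<close> has to satisfy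
  \<open>g u - norm (u - a) \<le> c \<le> norm (w + a) - g w\<close> for all \<open>u, w\<close> in \<open>W\<close>, and the triangle inequality
  makes this possible.\<close>

lemma finite_dimensional_Hahn_Banach:
  fixes z :: "'a::real_normed_vector"
  assumes "finite S"
  shows "\<exists>g. linear g \<and> g z = norm z \<and> (\<forall>x\<in>span (insert z S). g x \<le> norm x)"
  using assms
proof (induction S rule: finite_induct)
  case empty
  show ?case
  proof (cases "z = 0")
    case True
    have "linear (\<lambda>x::'a. 0::real)" by (rule linear_zero)
    then show ?thesis using True by (intro exI[of _ "\<lambda>x. 0"]) auto
  next
    case False
    obtain h :: "'a \<Rightarrow> real" where h: "linear h" "h z = 1"
      using linear_functional_separating_subspace[of "{0}" z] False
      by (auto simp: subspace_single_0)
    have "linear (\<lambda>x. norm z *\<^sub>R h x)" by (rule linear_compose_scale_right[OF h(1)])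
    then show ?thesis
      using h by (intro exI[of _ "\<lambda>x. norm z *\<^sub>R h x"])
        (auto simp: span_singleton linear_scale mult.commute intro!: mult_right_mono)
  qed
next
  case (insert a S)
  then obtain g where g: "linear g" "g z = norm z"
    "\<forall>x\<in>span (insert z S). g x \<le> norm x" by blast
  let ?W = "span (insert z S)"
  have ins: "insert z (insert a S) = insert a (insert z S)" by auto
  show ?case
  proof (cases "a \<in> ?W")
    case True
    then show ?thesis using g unfolding ins by (metis span_redundant)
  next
    case False
    obtain h :: "'a \<Rightarrow> real" where h: "linear h" "\<And>x. x \<in> ?W \<Longrightarrow> h x = 0" "h a = 1"
      using linear_functional_separating_subspace[OF subspace_span False] by blast
    have ineq: "g u - norm (u - a) \<le> norm (w + a) - g w" if "u \<in> ?W" "w \<in> ?W" for u w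
    proof -
      have "g u + g w = g (u + w)" using g(1) by (simp add: linear_add)
      also have "\<dots> \<le> norm (u + w)" using g(3) that span_add by blast
      also have "\<dots> \<le> norm (u - a) + norm (w + a)"
        using norm_triangle_ineq[of "u - a" "w + a"] by (simp add: add_ac)
      finally show ?thesis by simp
    qed
    define c where "c = (SUP u\<in>?W. g u - norm (u - a))"
    have bdd: "bdd_above ((\<lambda>u. g u - norm (u - a)) ` ?W)"
      using ineq[OF _ span_zero] by (auto intro!: bdd_aboveI)
    have lo: "g u - norm (u - a) \<le> c" if "u \<in> ?W" for u
      unfolding c_def using bdd that by (intro cSUP_upper)
    have hi: "c \<le> norm (w + a) - g w" if "w \<in> ?W" for w
      unfolding c_def using ineq[OF _ that] span_zero by (intro cSUP_least) auto
    define g' where "g' = (\<lambda>x. g x + (c - g a) *\<^sub>R h x)"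
    have lin: "linear g'"
      unfolding g'_def by (intro linear_compose_add g linear_compose_scale_right h)
    have val: "g' (w + t *\<^sub>R a) = g w + t * c" if "w \<in> ?W" for w t
      using h g(1) that by (simp add: g'_def linear_add linear_scale algebra_simps)
    have "g' x \<le> norm x" if mem: "x \<in> span (insert a (insert z S))" for x
    proof -
      obtain t where t: "x - t *\<^sub>R a \<in> ?W" using mem unfolding span_breakdown_eq[of x a] by blast
      define w where "w = x - t *\<^sub>R a"
      have w: "w \<in> ?W" and x: "x = w + t *\<^sub>R a" using t by (auto simp: w_def)
      consider "t = 0" | "t > 0" | "t < 0" by linarith
      then have "g w + t * c \<le> norm (w + t *\<^sub>R a)"
      proof cases
        case 1
        then show ?thesis using g(3) w by simp
      next
        case 2
        have "(1/t) *\<^sub>R w \<in> ?W" using w by (rule span_scale)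
        from hi[OF this] have "c \<le> norm ((1/t) *\<^sub>R w + a) - g w / t"
          using g(1) by (simp add: linear_scale)
        also have "(1/t) *\<^sub>R w + a = (1/t) *\<^sub>R (w + t *\<^sub>R a)"
          using 2 by (simp add: algebra_simps)
        finally have "c \<le> norm (w + t *\<^sub>R a) / t - g w / t"
          using 2 by (simp only: norm_scaleR) simp
        then show ?thesis using 2 by (simp add: field_simps)
      next
        case 3
        have "(-1/t) *\<^sub>R w \<in> ?W" using w by (rule span_scale)
        from lo[OF this] have "- g w / t - norm ((-1/t) *\<^sub>R w - a) \<le> c"
          using g(1) by (simp add: linear_scale linear_neg)
        also have "(-1/t) *\<^sub>R w - a = (-1/t) *\<^sub>R (w + t *\<^sub>R a)"
          using 3 by (simp add: algebra_simps)
        finally have "- g w / t - norm (w + t *\<^sub>R a) / (- t) \<le> c"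
          using 3 by (simp only: norm_scaleR) simp
        then show ?thesis using 3 by (simp add: field_simps)
      qed
      then show ?thesis using val[OF w] x by simp
    qed
    moreover have "g' z = norm z"
      using g(2) h(2)[OF span_base[of z]] by (simp add: g'_def)
    ultimately show ?thesis using lin unfolding ins by blast
  qed
qed

lemma exists_norming_functional:
  fixes z :: "'a::real_normed_vector"
  assumes B: "finite B" "span B = (UNIV::'a set)"
  obtains g :: "'a \<Rightarrow>\<^sub>L real" where "norm g \<le> 1" "blinfun_apply g z = norm z"
proof -
  obtain g where g: "linear g" "g z = norm z" "\<forall>x\<in>span (insert z B). g x \<le> norm x"
    using finite_dimensional_Hahn_Banach[OF B(1)] by blast
  have U: "span (insert z B) = UNIV" using B(2) by (simp add: span_redundant)
  have bl: "bounded_linear g" by (rule linear_imp_bounded_linear_if_finite_span[OF B g(1)])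
  have "\<bar>g x\<bar> \<le> norm x" for x
    using g(3) U linear_neg[OF g(1), of x] norm_minus_cancel[of x]
    by (metis UNIV_I abs_le_iff)
  then have "norm (Blinfun g) \<le> 1"
    using bl by (intro norm_blinfun_bound) (auto simp: bounded_linear_Blinfun_apply)
  then show ?thesis using that[of "Blinfun g"] bl g(2) by (simp add: bounded_linear_Blinfun_apply)
qed

section \<open>Extreme points of the unit ball determine the dual norm\<close>

text \<open>Among the maximisers of \<open>f\<close>, one picks a maximiser of a strictly convex continuous function,
  namely the sum of the squared coordinates with respect to a basis. If such a point were inside a
  segment of \<open>C\<close>, then both end points would maximise \<open>f\<close> as well, against strict convexity.\<close>

lemma exists_extreme_maximizer:
  fixes f :: "'a::real_normed_vector \<Rightarrow>\<^sub>L real" and C :: "'a set"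
  assumes B: "finite B" "span B = (UNIV::'a set)" and C: "compact C" "C \<noteq> {}"
  obtains e where "e extreme_point_of C" "\<And>x. x \<in> C \<Longrightarrow> f x \<le> f e"
proof -
  obtain D :: "'a set" where D: "independent D" "span D = UNIV"
    using basis_exists[of "UNIV::'a set"] by (metis top.extremum_uniqueI)
  have fD: "finite D" using independent_span_bound[OF B(1) D(1)] B(2) by auto
  define co where "co = (\<lambda>d x. representation D x d)"
  have lin: "linear (co d)" for d
    unfolding co_def using D by (intro linearI) (simp_all add: representation_add representation_scale)
  have "continuous_on C (co d)" for d
    by (intro linear_continuous_on linear_imp_bounded_linear_if_finite_span[OF B lin])
  then have cont: "continuous_on C (\<lambda>x. \<Sum>d\<in>D. (co d x)\<^sup>2)"
    by (intro continuous_intros)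
  have eqI: "a = b" if "\<And>d. d \<in> D \<Longrightarrow> co d a = co d b" for a b
  proof -
    have "(\<Sum>d\<in>D. co d a *\<^sub>R d) = a" "(\<Sum>d\<in>D. co d b *\<^sub>R d) = b"
      unfolding co_def using D fD by (auto intro!: sum_representation_eq)
    moreover have "(\<Sum>d\<in>D. co d a *\<^sub>R d) = (\<Sum>d\<in>D. co d b *\<^sub>R d)"
      using that by (intro sum.cong) auto
    ultimately show ?thesis by metis
  qed
  obtain m where m: "m \<in> C" "\<And>x. x \<in> C \<Longrightarrow> f x \<le> f m"
    using continuous_attains_sup[OF C, of "blinfun_apply f"] linear_continuous_on[OF blinfun.bounded_linear_right]
    by metis
  let ?M = "C \<inter> {x. f x = f m}"
  have "compact ?M"
    by (intro compact_Int_closed C closed_Collect_eq continuous_intros)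
  moreover have "?M \<noteq> {}" using m by auto
  moreover have "continuous_on ?M (\<lambda>x. \<Sum>d\<in>D. (co d x)\<^sup>2)"
    by (rule continuous_on_subset[OF cont]) auto
  ultimately obtain e where "e \<in> ?M"
    "\<forall>x\<in>?M. (\<Sum>d\<in>D. (co d x)\<^sup>2) \<le> (\<Sum>d\<in>D. (co d e)\<^sup>2)"
    by (rule continuous_attains_sup[THEN bexE])
  then have e: "e \<in> ?M"
    "\<And>x. x \<in> ?M \<Longrightarrow> (\<Sum>d\<in>D. (co d x)\<^sup>2) \<le> (\<Sum>d\<in>D. (co d e)\<^sup>2)" by blast+
  have "e extreme_point_of C"
    unfolding extreme_point_of_def
  proof (intro conjI ballI notI)
    show "e \<in> C" using e by simp
    fix a b assume ab: "a \<in> C" "b \<in> C" "e \<in> open_segment a b"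
    then obtain u where u: "a \<noteq> b" "0 < u" "u < 1" "e = (1 - u) *\<^sub>R a + u *\<^sub>R b"
      by (auto simp: in_segment)
    have fe: "f m = (1 - u) * f a + u * f b"
      using e(1) u(4) by (simp add: blinfun.add_right blinfun.scaleR_right)
    have "f a = f m \<and> f b = f m"
    proof -
      have "(1 - u) * (f m - f a) + u * (f m - f b) = 0" using fe by (simp add: algebra_simps)
      moreover have "(1 - u) * (f m - f a) \<ge> 0" "u * (f m - f b) \<ge> 0"
        using u m(2)[OF ab(1)] m(2)[OF ab(2)] by auto
      ultimately have "(1 - u) * (f m - f a) = 0" "u * (f m - f b) = 0" by linarith+
      then show ?thesis using u by simp
    qed
    then have abM: "a \<in> ?M" "b \<in> ?M" using ab by auto
    \<comment> \<open>Strict convexity of the square, with its exact defect.\<close>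
    have "(co d e)\<^sup>2 = (1 - u) * (co d a)\<^sup>2 + u * (co d b)\<^sup>2 - u * (1 - u) * (co d a - co d b)\<^sup>2" for d
    proof -
      have eq: "co d e = (1 - u) * co d a + u * co d b"
        using linear_add[OF lin[of d]] linear_scale[OF lin[of d]] by (simp only: u(4)) simp
      show ?thesis unfolding eq by (simp add: power2_eq_square algebra_simps)
    qed
    then have "(\<Sum>d\<in>D. (co d e)\<^sup>2) = (1 - u) * (\<Sum>d\<in>D. (co d a)\<^sup>2) + u * (\<Sum>d\<in>D. (co d b)\<^sup>2)
        - u * (1 - u) * (\<Sum>d\<in>D. (co d a - co d b)\<^sup>2)"
      by (simp add: sum.distrib sum_subtractf sum_distrib_left)
    also have "\<dots> \<le> (1 - u) * (\<Sum>d\<in>D. (co d e)\<^sup>2) + u * (\<Sum>d\<in>D. (co d e)\<^sup>2)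
        - u * (1 - u) * (\<Sum>d\<in>D. (co d a - co d b)\<^sup>2)"
      using u e(2)[OF abM(1)] e(2)[OF abM(2)]
      by (intro diff_right_mono add_mono mult_left_mono) auto
    finally have "u * (1 - u) * (\<Sum>d\<in>D. (co d a - co d b)\<^sup>2) \<le> 0"
      by (simp add: algebra_simps)
    then have "(\<Sum>d\<in>D. (co d a - co d b)\<^sup>2) \<le> 0"
      using u by (simp add: mult_le_0_iff)
    then have "(\<Sum>d\<in>D. (co d a - co d b)\<^sup>2) = 0"
      by (intro antisym sum_nonneg) auto
    then have "\<forall>d\<in>D. co d a = co d b" using fD by (simp add: sum_nonneg_eq_0_iff)
    then show False using eqI u(1) by blast
  qed
  then show ?thesis using that m e(1) by auto
qed

text \<open>The vertices of the unit ball at which the constraint \<open>f e \<le> 1\<close> on \<open>f\<close> is active, when the dual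
  unit ball is seen as the polyhedron cut out by these constraints.\<close>

definition contact_points :: "('a::real_normed_vector \<Rightarrow>\<^sub>L real) \<Rightarrow> 'a set" where
  "contact_points f = {e. e extreme_point_of cball 0 1 \<and> f e = 1}"

text \<open>A functional attains its maximum over the ball at an extreme point. When these points are finite in
  number, this presents the dual unit ball by finitely many linear inequalities.\<close>

lemma norm_le_1_iff_extreme_points:
  fixes f :: "'a::real_normed_vector \<Rightarrow>\<^sub>L real"
  assumes B: "finite B" "span B = (UNIV::'a set)"
  shows "norm f \<le> 1 \<longleftrightarrow> (\<forall>e. e extreme_point_of cball 0 1 \<longrightarrow> f e \<le> 1)"
proof
  assume "norm f \<le> 1"
  show "\<forall>e. e extreme_point_of cball 0 1 \<longrightarrow> f e \<le> 1"
  proof (intro allI impI)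
    fix e :: 'a assume "e extreme_point_of cball 0 1"
    then have "norm e \<le> 1" by (simp add: extreme_point_of_def)
    then have "norm f * norm e \<le> 1" using \<open>norm f \<le> 1\<close> by (simp add: mult_le_one)
    then show "f e \<le> 1" using norm_blinfun[of f e] by simp
  qed
next
  assume E: "\<forall>e. e extreme_point_of cball 0 1 \<longrightarrow> f e \<le> 1"
  have "compact (cball (0::'a) 1)"
    using compact_span_Int_cball[OF B(1), of 1] B(2) by simp
  then obtain e where "e extreme_point_of cball 0 1" and e: "\<And>x. x \<in> cball 0 1 \<Longrightarrow> f x \<le> f e"
    using exists_extreme_maximizer[OF B, of "cball 0 1" f] by auto
  with E have ball: "f x \<le> 1" if "norm x \<le> 1" for x
    using that by fastforce
  have "f x \<le> norm x" for x
  proof (cases "x = 0")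
    case False
    have "f ((1 / norm x) *\<^sub>R x) \<le> 1" using False by (intro ball) simp
    then show ?thesis using False by (simp add: blinfun.scaleR_right field_simps)
  qed simp
  from this this[of "- x" for x] show "norm f \<le> 1"
    by (intro norm_blinfun_bound) (auto simp: blinfun.minus_right abs_le_iff)
qed

text \<open>Otherwise some \<open>g \<noteq> 0\<close> vanishes at all contact points. The remaining finitely many constraints
  are slack at \<open>f\<close>, so \<open>f + r g\<close> and \<open>f - r g\<close> both stay in the dual ball for small \<open>r > 0\<close>,
  and \<open>f\<close> is their midpoint.\<close>

lemma extreme_point_imp_span_contact_points:
  fixes f :: "'a::real_normed_vector \<Rightarrow>\<^sub>L real"
  assumes B: "finite B" "span B = (UNIV::'a set)"
    and fin: "finite {e::'a. e extreme_point_of cball 0 1}"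
    and f: "f extreme_point_of cball 0 1"
  shows "span (contact_points f) = UNIV"
proof (rule ccontr)
  assume "span (contact_points f) \<noteq> UNIV"
  then obtain a where a: "a \<notin> span (contact_points f)" by auto
  obtain h :: "'a \<Rightarrow> real" where h: "linear h" "\<And>x. x \<in> span (contact_points f) \<Longrightarrow> h x = 0" "h a = 1"
    using linear_functional_separating_subspace[OF subspace_span a] by blast
  define g where "g = Blinfun h"
  have g: "blinfun_apply g = h"
    unfolding g_def
    by (intro bounded_linear_Blinfun_apply linear_imp_bounded_linear_if_finite_span[OF B h(1)])
  let ?E = "{e::'a. e extreme_point_of cball 0 1}"
  have nf: "norm f \<le> 1" using f by (simp add: extreme_point_of_def)
  have slack: "f e < 1" if "e \<in> ?E - contact_points f" for e
    using that nf unfolding norm_le_1_iff_extreme_points[OF B]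
    by (auto simp: contact_points_def order_less_le)
  have "\<forall>\<^sub>F r in at_right 0. \<forall>e\<in>?E - contact_points f. r * \<bar>h e\<bar> < 1 - f e"
  proof (subst eventually_ball_finite_distrib, use fin in simp, intro ballI)
    fix e assume "e \<in> ?E - contact_points f"
    then have "0 * \<bar>h e\<bar> < 1 - f e" using slack by simp
    moreover have "((\<lambda>r. r * \<bar>h e\<bar>) \<longlongrightarrow> 0 * \<bar>h e\<bar>) (at_right 0)"
      by (intro tendsto_intros)
    ultimately show "\<forall>\<^sub>F r in at_right 0. r * \<bar>h e\<bar> < 1 - f e"
      by (intro order_tendstoD)
  qed
  moreover have "\<forall>\<^sub>F r in at_right 0. r > (0::real)" by (simp add: eventually_at_right_less)
  ultimately have "\<forall>\<^sub>F r in at_right 0. r > 0 \<and> (\<forall>e\<in>?E - contact_points f. r * \<bar>h e\<bar> < 1 - f e)"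
    by eventually_elim simp
  then obtain r where r: "r > 0" "\<And>e. e \<in> ?E - contact_points f \<Longrightarrow> r * \<bar>h e\<bar> < 1 - f e"
    using eventually_happens'[OF trivial_limit_at_right_real] by blast
  have *: "norm (f + s *\<^sub>R g) \<le> 1" if "\<bar>s\<bar> = r" for s
    unfolding norm_le_1_iff_extreme_points[OF B]
  proof (intro allI impI)
    fix e :: 'a assume e: "e extreme_point_of cball 0 1"
    show "(f + s *\<^sub>R g) e \<le> 1"
    proof (cases "e \<in> contact_points f")
      case True
      then show ?thesis using h(2)[OF span_base[OF True]]
        by (simp add: contact_points_def g blinfun.add_left blinfun.scaleR_left)
    next
      case False
      have "s * h e \<le> r * \<bar>h e\<bar>" using that by (metis abs_ge_self abs_mult)
      then show ?thesis using r(2)[of e] e False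
        by (simp add: g blinfun.add_left blinfun.scaleR_left)
    qed
  qed
  have "g \<noteq> 0" using g h(3) by (metis blinfun.zero_left zero_neq_one)
  have "f = midpoint (f + r *\<^sub>R g) (f + (- r) *\<^sub>R g)"
    by (simp add: midpoint_def algebra_simps flip: scaleR_2)
  moreover have "f + r *\<^sub>R g \<noteq> f + (- r) *\<^sub>R g"
    using \<open>g \<noteq> 0\<close> r(1) by (simp add: eq_neg_iff_add_eq_0 flip: scaleR_2)
  ultimately have "f \<in> open_segment (f + r *\<^sub>R g) (f + (- r) *\<^sub>R g)"
    by (metis midpoint_in_open_segment)
  moreover have "f + r *\<^sub>R g \<in> cball 0 1" "f + (- r) *\<^sub>R g \<in> cball 0 1"
    using *[of r] *[of "- r"] r(1) by simp_all
  ultimately show False using f unfolding extreme_point_of_def by blast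
qed

text \<open>If \<open>f\<close> is a proper convex combination of \<open>g\<close> and \<open>h\<close> in the dual ball, then \<open>g\<close> and \<open>h\<close> are
  at most \<open>1\<close> on \<open>F\<close>, where \<open>f\<close> is \<open>1\<close>. Hence both are \<open>1\<close> on \<open>F\<close>, and so they agree on its span.\<close>

lemma extreme_point_if_span_contact_set:
  fixes f :: "'a::real_normed_vector \<Rightarrow>\<^sub>L real"
  assumes f: "norm f \<le> 1" and F: "F \<subseteq> cball 0 1" "\<And>x. x \<in> F \<Longrightarrow> f x = 1" "span F = UNIV"
  shows "f extreme_point_of cball 0 1"
  unfolding extreme_point_of_def
proof (intro conjI ballI notI)
  show "f \<in> cball 0 1" using f by simp
  fix g h assume gh: "g \<in> cball 0 1" "h \<in> cball 0 1" "f \<in> open_segment g h"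
  then obtain u where u: "g \<noteq> h" "0 < u" "u < 1" "f = (1 - u) *\<^sub>R g + u *\<^sub>R h"
    by (auto simp: in_segment)
  have le: "k x \<le> 1" if "norm k \<le> 1" "x \<in> F" for k :: "'a \<Rightarrow>\<^sub>L real" and x
  proof -
    have "norm x \<le> 1" using F(1) that by auto
    then have "norm k * norm x \<le> 1" using that by (simp add: mult_le_one)
    then show ?thesis using norm_blinfun[of k x] by simp
  qed
  have eq: "g x = h x" if x: "x \<in> F" for x
  proof -
    have "(1 - u) * g x + u * h x = 1"
      using F(2)[OF x] u(4) by (simp add: blinfun.add_left blinfun.scaleR_left)
    then have "(1 - u) * (1 - g x) + u * (1 - h x) = 0" by (simp add: algebra_simps)
    moreover have "(1 - u) * (1 - g x) \<ge> 0" "u * (1 - h x) \<ge> 0"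
      using u gh le[OF _ x] by auto
    ultimately have "(1 - u) * (1 - g x) = 0" "u * (1 - h x) = 0" by linarith+
    then show ?thesis using u by simp
  qed
  have "g x = h x" for x
    by (rule linear_eq_on_span[of g h F])
      (use eq F(3) in \<open>auto intro: bounded_linear.linear blinfun.bounded_linear_right\<close>)
  then show False using u(1) by (auto intro: blinfun_eqI)
qed

section \<open>The unit ball as a polyhedron\<close>

text \<open>Such a functional is determined by its contact points, a subset of a finite set.\<close>

lemma finite_spanning_contact_functionals:
  assumes fin: "finite {e::'a::real_normed_vector. e extreme_point_of cball 0 1}"
  shows "finite {f::'a \<Rightarrow>\<^sub>L real. span (contact_points f) = UNIV}" (is "finite ?V")
proof (rule finite_imageD)
  have "contact_points ` ?V \<subseteq> Pow {e::'a. e extreme_point_of cball 0 1}"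
    by (auto simp: contact_points_def)
  then show "finite (contact_points ` ?V)" using fin finite_subset by blast
  show "inj_on contact_points ?V"
  proof (rule inj_onI)
    fix f g :: "'a \<Rightarrow>\<^sub>L real" assume fg: "f \<in> ?V" "g \<in> ?V" "contact_points f = contact_points g"
    have "f x = g x" for x
    proof (rule linear_eq_on_span[of f g "contact_points f"])
      show "f e = g e" if "e \<in> contact_points f" for e
        using that fg(3) by (auto simp: contact_points_def set_eq_iff)
    qed (use fg in \<open>auto intro: bounded_linear.linear blinfun.bounded_linear_right\<close>)
    then show "f = g" by (auto intro: blinfun_eqI)
  qed
qed

text \<open>A pivoting argument, as in the simplex algorithm. As long as the contact points do not span, there is a
  direction \<open>g\<close> that leaves the active constraints active and does not decrease the value at \<open>z\<close>.
  The dual ball is bounded, so moving along \<open>g\<close> hits a further constraint, which enlarges the set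
  of contact points.\<close>

lemma exists_dominating_spanning_contact_functional:
  fixes f :: "'a::real_normed_vector \<Rightarrow>\<^sub>L real"
  assumes B: "finite B" "span B = (UNIV::'a set)"
    and fin: "finite {e::'a. e extreme_point_of cball 0 1}"
    and f: "norm f \<le> 1"
  shows "\<exists>f' :: 'a \<Rightarrow>\<^sub>L real. norm f' \<le> 1 \<and> f z \<le> blinfun_apply f' z \<and> span (contact_points f') = UNIV"
  using f
proof (induction "card {e::'a. e extreme_point_of cball 0 1} - card (contact_points f)"
    arbitrary: f rule: less_induct)
  case less
  let ?E = "{e::'a. e extreme_point_of cball 0 1}"
  have sub: "contact_points k \<subseteq> ?E" for k :: "'a \<Rightarrow>\<^sub>L real" by (auto simp: contact_points_def)
  show ?case
  proof (cases "span (contact_points f) = UNIV")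
    case True
    then show ?thesis using less.prems by blast
  next
    case False
    then obtain a where a: "a \<notin> span (contact_points f)" by auto
    obtain h :: "'a \<Rightarrow> real" where h: "linear h" "\<And>x. x \<in> span (contact_points f) \<Longrightarrow> h x = 0" "h a = 1"
      using linear_functional_separating_subspace[OF subspace_span a] by blast
    define h' where "h' = Blinfun h"
    have h': "blinfun_apply h' = h"
      unfolding h'_def
      by (intro bounded_linear_Blinfun_apply linear_imp_bounded_linear_if_finite_span[OF B h(1)])
    define g where "g = (if h' z \<ge> 0 then h' else - h')"
    have gz: "g z \<ge> 0" by (simp add: g_def blinfun.minus_left)
    have g0: "g e = 0" if "e \<in> contact_points f" for e
      using h(2)[OF span_base[OF that]] by (simp add: g_def h' blinfun.minus_left)
    have "g a \<noteq> 0" using h(3) by (simp add: g_def h' blinfun.minus_left)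
    then have gnz: "g \<noteq> 0" by auto
    let ?P = "{e \<in> ?E. g e > 0}"
    \<comment> \<open>Constraints that tighten along g. Without one, the whole ray would stay in the dual ball.\<close>
    have "?P \<noteq> {}"
    proof
      assume P: "?P = {}"
      have "norm ((2 / norm g) *\<^sub>R g) \<le> 1"
        unfolding norm_le_1_iff_extreme_points[OF B]
      proof (intro allI impI)
        fix e :: 'a assume "e extreme_point_of cball 0 1"
        then have "g e \<le> 0" using P by force
        then have "2 / norm g * g e \<le> 0" by (intro mult_nonneg_nonpos) auto
        then show "((2 / norm g) *\<^sub>R g) e \<le> 1" by (simp add: blinfun.scaleR_left)
      qed
      then show False using gnz by simp
    qed
    moreover have finP: "finite ?P" using fin by simp
    ultimately obtain e0 where e0: "e0 \<in> ?P"
      "\<And>e. e \<in> ?P \<Longrightarrow> (1 - f e0) / g e0 \<le> (1 - f e) / g e"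
      using ex_min_if_finite[of "(\<lambda>e. (1 - f e) / g e) ` ?P"]
      by (fastforce simp: not_less)
    \<comment> \<open>The largest step that keeps all constraints; the one at e0 becomes active.\<close>
    define t where "t = (1 - f e0) / g e0"
    have fle: "f e \<le> 1" if "e \<in> ?E" for e
      using less.prems that unfolding norm_le_1_iff_extreme_points[OF B] by blast
    have t: "t \<ge> 0" using e0(1) fle by (simp add: t_def)
    define f' where "f' = f + t *\<^sub>R g"
    have f'_apply: "f' x = f x + t * g x" for x
      by (simp add: f'_def blinfun.add_left blinfun.scaleR_left)
    have "norm f' \<le> 1"
      unfolding norm_le_1_iff_extreme_points[OF B]
    proof (intro allI impI)
      fix e :: 'a assume e: "e extreme_point_of cball 0 1"
      show "f' e \<le> 1"
      proof (cases "g e > 0")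
        case True
        then have "t \<le> (1 - f e) / g e" unfolding t_def using e by (intro e0(2)) simp
        then show ?thesis using True by (simp add: f'_apply field_simps)
      next
        case False
        then have "t * g e \<le> 0" using t by (simp add: mult_nonneg_nonpos)
        then show ?thesis using fle[of e] e by (simp add: f'_apply)
      qed
    qed
    moreover have "card ?E - card (contact_points f') < card ?E - card (contact_points f)"
    proof -
      have "e0 \<in> contact_points f'"
        using e0(1) by (simp add: contact_points_def f'_apply t_def)
      moreover have "e0 \<notin> contact_points f" using g0 e0(1) by force
      moreover have "contact_points f \<subseteq> contact_points f'"
        using g0 by (auto simp: contact_points_def f'_apply)
      ultimately have "contact_points f \<subset> contact_points f'" by blast
      then have "card (contact_points f) < card (contact_points f')"
        using finite_subset[OF sub fin] by (intro psubset_card_mono) auto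
      moreover have "card (contact_points f') \<le> card ?E" by (rule card_mono[OF fin sub])
      ultimately show ?thesis by linarith
    qed
    ultimately obtain f'' where "norm f'' \<le> 1" "f' z \<le> blinfun_apply f'' z" "span (contact_points f'') = UNIV"
      using less.hyps by blast
    moreover have "f z \<le> f' z" using t gz by (simp add: f'_apply)
    ultimately show ?thesis by (meson order_trans)
  qed
qed

text \<open>The half-spaces \<open>g \<le> 1\<close>, for the finitely many \<open>g\<close> in the dual ball whose contact points span,
  cut out the ball: a norming functional of \<open>x\<close> is dominated at \<open>x\<close> by one of these \<open>g\<close>, and so
  \<open>norm x \<le> 1\<close> as soon as each \<open>g x \<le> 1\<close>. Since \<open>f \<noteq> 0\<close> excludes the zero space, no such \<open>g\<close> is
  zero.\<close>

lemma bounded_polyhedron_unit_ball: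
  fixes f :: "'a::real_normed_vector \<Rightarrow>\<^sub>L real"
  assumes B: "finite B" "span B = (UNIV::'a set)"
    and fin: "finite {e::'a. e extreme_point_of cball 0 1}"
    and nontrivial: "f \<noteq> 0"
  shows "bounded_polyhedron (cball (0::'a) 1)"
proof -
  let ?V = "{g::'a \<Rightarrow>\<^sub>L real. norm g \<le> 1 \<and> span (contact_points g) = UNIV}"
  let ?H = "(\<lambda>g. {x. blinfun_apply g x \<le> 1}) ` ?V"
  have "finite ?V" by (rule finite_subset[OF _ finite_spanning_contact_functionals[OF fin]]) auto
  then have "finite ?H" by simp
  moreover have "closed_halfspace M" if "M \<in> ?H" for M
  proof -
    from that obtain g where g: "span (contact_points g) = UNIV" "M = {x. blinfun_apply g x \<le> 1}"
      by auto
    have "g \<noteq> 0"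
    proof
      assume "g = 0"
      then have "contact_points g = {}" by (auto simp: contact_points_def)
      then have "(UNIV::'a set) = {0}" using g(1) by simp
      then have "f x = 0" for x by (metis UNIV_I blinfun.zero_right singletonD)
      then show False using nontrivial by (auto intro: blinfun_eqI)
    qed
    then show ?thesis using g(2) by (auto simp: closed_halfspace_def)
  qed
  moreover have "cball (0::'a) 1 = \<Inter>?H"
  proof (intro equalityI subsetI)
    fix x :: 'a assume x: "x \<in> cball 0 1"
    have "g x \<le> 1" if "norm g \<le> 1" for g :: "'a \<Rightarrow>\<^sub>L real"
    proof -
      have "norm g * norm x \<le> 1" using that x by (simp add: mult_le_one)
      then show ?thesis using norm_blinfun[of g x] by simp
    qed
    then show "x \<in> \<Inter>?H" by auto
  next
    fix x :: 'a assume x: "x \<in> \<Inter>?H"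
    obtain g :: "'a \<Rightarrow>\<^sub>L real" where "norm g \<le> 1" "g x = norm x"
      using exists_norming_functional[OF B] by blast
    then obtain g' :: "'a \<Rightarrow>\<^sub>L real" where "g' \<in> ?V" "norm x \<le> g' x"
      using exists_dominating_spanning_contact_functional[OF B fin, of g x] by auto
    then show "x \<in> cball 0 1" using x by fastforce
  qed
  moreover have "compact (cball (0::'a) 1)"
    using compact_span_Int_cball[OF B(1), of 1] B(2) by simp
  moreover have "cball (0::'a) 1 \<noteq> {}" by simp
  ultimately show ?thesis unfolding bounded_polyhedron_def by blast
qed

lemma bounded_polyhedron_Int_halfspace:
  assumes P: "bounded_polyhedron P" and M: "closed_halfspace M" and ne: "P \<inter> M \<noteq> {}"
  shows "bounded_polyhedron (P \<inter> M)"
proof -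
  obtain H where H: "finite H" "\<forall>M\<in>H. closed_halfspace M" "P = \<Inter>H" "compact P"
    using P by (auto simp: bounded_polyhedron_def)
  have "closed M" using M
    by (auto simp: closed_halfspace_def intro!: closed_Collect_le linear_continuous_on
        blinfun.bounded_linear_right continuous_intros)
  then have "compact (P \<inter> M)" using H(4) by (rule compact_Int_closed[rotated])
  moreover have "finite (insert M H) \<and> (\<forall>N\<in>insert M H. closed_halfspace N) \<and> P \<inter> M = \<Inter>(insert M H)"
    using H M by auto
  ultimately show ?thesis unfolding bounded_polyhedron_def using ne by blast
qed

lemma frontier_halfspace_blinfun:
  fixes g :: "'a::real_normed_vector \<Rightarrow>\<^sub>L real"
  assumes "g \<noteq> 0"
  shows "frontier {x. g x \<le> c} = {x. g x = c}"
proof -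
  have closed: "closed {x. g x \<le> c}"
    by (intro closed_Collect_le continuous_intros)
  obtain u where u: "g u > 0"
  proof -
    obtain v where "g v \<noteq> 0" using assms by (metis blinfun_eqI blinfun.zero_left)
    then show ?thesis using that[of v] that[of "- v"]
      by (cases "g v > 0") (auto simp: blinfun.minus_right)
  qed
  have "interior {x. g x \<le> c} = {x. g x < c}"
  proof
    have "open {x. g x < c}" by (intro open_Collect_less continuous_intros)
    then show "{x. g x < c} \<subseteq> interior {x. g x \<le> c}" by (intro interior_maximal) auto
    show "interior {x. g x \<le> c} \<subseteq> {x. g x < c}"
    proof
      fix x assume x: "x \<in> interior {x. g x \<le> c}"
      then obtain e where e: "e > 0" "cball x e \<subseteq> {x. g x \<le> c}"
        by (auto simp: mem_interior_cball)
      have "u \<noteq> 0" using u by auto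
      define r where "r = e / norm u"
      have r: "r > 0" using e(1) \<open>u \<noteq> 0\<close> by (simp add: r_def)
      have "x + r *\<^sub>R u \<in> cball x e" using e(1) \<open>u \<noteq> 0\<close> by (simp add: dist_norm r_def)
      then have "g x + r * g u \<le> c"
        using e(2) by (auto simp: blinfun.add_right blinfun.scaleR_right)
      moreover have "r * g u > 0" using r u by simp
      ultimately show "x \<in> {x. g x < c}" by simp
    qed
  qed
  then show ?thesis using closed by (auto simp: frontier_def)
qed

section \<open>Facets and extreme points of the dual ball\<close>

text \<open>The differences of points of \<open>F\<close> lie in the kernel of \<open>f\<close>, while \<open>f v = 1\<close>. Adding \<open>v\<close> to them
  gives the span of \<open>F\<close> and raises the dimension by exactly one.\<close>

lemma span_UNIV_iff_polyhedron_dim: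
  fixes f :: "'a::real_normed_vector \<Rightarrow>\<^sub>L real"
  assumes B: "finite B" "span B = (UNIV::'a set)"
    and v: "v \<in> F" and f: "\<And>x. x \<in> F \<Longrightarrow> f x = 1"
  shows "span F = UNIV \<longleftrightarrow> polyhedron_dim F + 1 = dim (UNIV::'a set)"
proof -
  obtain D :: "'a set" where D: "independent D" "span D = UNIV"
    using basis_exists[of "UNIV::'a set"] by (metis top.extremum_uniqueI)
  have fD: "finite D" using independent_span_bound[OF B(1) D(1)] B(2) by auto
  interpret fd: finite_dimensional_vector_space "scaleR :: real \<Rightarrow> 'a \<Rightarrow> 'a" D
    by unfold_locales (use fD D in \<open>auto simp: dependent_raw_def span_raw_def\<close>)
  note dim_insert = fd.dim_insert[folded dim_raw_def span_raw_def]
  note dim_eq_full = fd.dim_eq_full[folded dim_raw_def span_raw_def, unfolded fd.dimension_def]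
  have card_D: "card D = dim (UNIV::'a set)" using D by (metis dim_eq_card span_UNIV)
  let ?D = "{v - w |v w. v \<in> F \<and> w \<in> F}"
  have fD0: "f x = 0" if "x \<in> span ?D" for x
    by (rule linear_eq_0_on_span[of f ?D])
      (use that f in \<open>auto simp: blinfun.diff_right intro: bounded_linear.linear blinfun.bounded_linear_right\<close>)
  have nv: "v \<notin> span ?D" using fD0 f[OF v] by force
  have eq: "span (insert v ?D) = span F"
  proof (rule antisym)
    have "insert v ?D \<subseteq> span F" using v by (auto intro: span_base span_diff)
    then show "span (insert v ?D) \<subseteq> span F" by (simp add: span_minimal)
    have "F \<subseteq> span (insert v ?D)"
    proof
      fix x assume "x \<in> F"
      then have "x - v \<in> span (insert v ?D)" using v by (intro span_base) auto
      then have "(x - v) + v \<in> span (insert v ?D)" by (intro span_add) (auto intro: span_base)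
      then show "x \<in> span (insert v ?D)" by simp
    qed
    then show "span F \<subseteq> span (insert v ?D)" by (simp add: span_minimal)
  qed
  have "polyhedron_dim F + 1 = dim (insert v ?D)"
    using dim_insert[of v ?D] nv by (simp add: polyhedron_dim_def)
  also have "\<dots> = dim F" using arg_cong[OF eq, of dim] by (simp only: dim_span)
  finally have "polyhedron_dim F + 1 = dim F" .
  then show ?thesis using dim_eq_full[of F] card_D by simp
qed

text \<open>In one direction the facet is the whole set of points of the ball where \<open>f\<close> is \<open>1\<close>: it contains
  all contact points, hence it spans, and so it has the right dimension. In the other direction \<open>f\<close> is \<open>1\<close> on the translate of its
  kernel through \<open>v\<close>, hence on the facet, which spans by its dimension.\<close>

theorem theorem2p1:
  fixes f :: "'a::banach \<Rightarrow>\<^sub>L real" and n :: nat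
  assumes "polyhedral_space TYPE('a)"
    and "dim (UNIV::'a set) = n"
    and "f \<in> sphere 0 1"
  shows "f extreme_point_of cball 0 1 \<longleftrightarrow>
           (\<exists>F. unit_ball_facet F \<and> supporting_functional f F)"
proof -
  obtain B :: "'a set" where B: "finite B" "span B = UNIV"
    and fin: "finite {e::'a. e extreme_point_of cball 0 1}"
    using assms(1) by (auto simp: polyhedral_space_def)
  have nf: "norm f = 1" using assms(3) by simp
  show ?thesis
  proof
    assume ext: "f extreme_point_of cball 0 1"
    define F where "F = {x \<in> cball 0 1. f x = 1}"
    have sp: "span F = UNIV"
    proof -
      have "contact_points f \<subseteq> F" by (auto simp: contact_points_def F_def extreme_point_of_def)
      from span_mono[OF this] show ?thesis
        using extreme_point_imp_span_contact_points[OF B fin ext] by auto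
    qed
    have f0: "f \<noteq> 0" using nf by auto
    have "F \<noteq> {}"
    proof
      assume "F = {}"
      then have "(UNIV::'a set) = {0}" using sp by simp
      then have "f x = 0" for x by (metis UNIV_I blinfun.zero_right singletonD)
      then show False using f0 by (auto intro: blinfun_eqI)
    qed
    then obtain v where v: "v \<in> F" by auto
    have le: "f x \<le> norm x" for x using norm_blinfun[of f x] nf by simp
    let ?M = "{x. f x \<le> 1}"
    have M: "closed_halfspace ?M" "closed_halfspace {x. (- f) x \<le> -1}"
      using f0 unfolding closed_halfspace_def by (metis neg_equal_0_iff_equal)+
    have ball: "bounded_polyhedron (cball (0::'a) 1)"
      by (rule bounded_polyhedron_unit_ball[OF B fin f0])
    have sub: "cball 0 1 \<subseteq> ?M"
    proof
      fix x :: 'a assume "x \<in> cball 0 1"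
      then show "x \<in> ?M" using le[of x] by simp
    qed
    have F_eq: "F = cball 0 1 \<inter> {x. (- f) x \<le> -1}" "F = cball 0 1 \<inter> frontier ?M"
      unfolding frontier_halfspace_blinfun[OF f0] using sub
      by (auto simp: F_def blinfun.minus_left intro: antisym)
    have "bounded_polyhedron F"
      using bounded_polyhedron_Int_halfspace[OF ball M(2)] v unfolding F_eq(1) by blast
    then have "polyhedron_face F (cball 0 1)"
      unfolding polyhedron_face_def using ball M(1) sub F_eq(2) by blast
    moreover have "polyhedron_dim F + 1 = dim (UNIV::'a set)"
      using span_UNIV_iff_polyhedron_dim[OF B v, of f] sp by (simp add: F_def)
    ultimately have facet: "unit_ball_facet F" by (simp add: unit_ball_facet_def)
    have "F = (\<lambda>x. v + x) ` {x. f x = 0} \<inter> sphere 0 1"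
    proof (intro equalityI subsetI)
      fix x assume x: "x \<in> F"
      then have "norm x = 1" using le[of x] by (auto simp: F_def)
      moreover have "f (x - v) = 0"
        using x v by (auto simp: F_def blinfun.diff_right)
      then have "x \<in> (\<lambda>x. v + x) ` {x. f x = 0}"
        by (intro image_eqI[of _ _ "x - v"]) simp_all
      ultimately show "x \<in> (\<lambda>x. v + x) ` {x. f x = 0} \<inter> sphere 0 1" by simp
    qed (use v in \<open>auto simp: F_def blinfun.add_right\<close>)
    moreover have "f v = norm f" using nf v by (simp add: F_def)
    ultimately have "supporting_functional f F"
      unfolding supporting_functional_def using nf v by blast
    then show "\<exists>F. unit_ball_facet F \<and> supporting_functional f F" using facet by blast
  next
    assume "\<exists>F. unit_ball_facet F \<and> supporting_functional f F"
    then obtain F v where F: "polyhedron_dim F + 1 = dim (UNIV::'a set)" and v: "v \<in> F" "f v = 1"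
      and F_eq: "F = (\<lambda>x. v + x) ` {x. f x = 0} \<inter> sphere 0 1"
      unfolding unit_ball_facet_def supporting_functional_def using nf by auto
    have one: "f x = 1" if "x \<in> F" for x
      using that v(2) by (subst (asm) F_eq) (auto simp: blinfun.add_right)
    have "span F = UNIV" using span_UNIV_iff_polyhedron_dim[OF B v(1) one] F by simp
    moreover have "F \<subseteq> cball 0 1" by (subst F_eq) auto
    ultimately show "f extreme_point_of cball 0 1"
      using extreme_point_if_span_contact_set[of f F] nf one by simp
  qed
qed

end
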